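(* Let $k$ be a field of characteristic $p>0$ and let $n\ge2$ be an integer. Let $A(T)$ and $B(T)$ be exponential matrices belonging to $\mathfrak{J}_{[n]}^E$ with the forms $$A(T)=\mathrm{Exp}\Big(\sum_{i=1}^{n-1}f_i\nu_n^i\Big),\qquad B(T)=\mathrm{Exp}\Big(\sum_{i=1}^{n-1}g_i\nu_n^i\Big),$$ where $f_i$ $(1\le i\le n-1)$ are $p$-polynomials with $f_1\ne0$ and $g_i$ $(1\le i\le n-1)$ are $p$-polynomials with $g_1\ne0$. Then the following conditions are equivalent: (1) $A(T)$ and $B(T)$ are equivalent, i.e. $P^{-1}A(T)P=B(T)$ for some $P\in GL(n,k)$. (2) There exists a matrix $Q\in\mathcal{Q}_{[n]}$ such that $(g_1,\dots,g_{n-1})=(f_1,\dots,f_{n-1})\,Q$.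
   Context: $k[T]$ is the polynomial ring in one variable. $A(T)\in\mathrm{Mat}(n,k[T])$ is exponential if $A(0)=I_n$ and $A(T)A(T')=A(T+T')$ ($T,T'$ indeterminates over $k$). A $p$-polynomial is a polynomial $\sum_{i\ge0}c_iT^{p^i}$, $c_i\in k$. $\mathrm{Exp}(M):=\sum_{i=0}^{p-1}\frac1{i!}M^i$ is the truncated exponential. $\nu_n\in\mathrm{Mat}(n,k)$ is the nilpotent matrix with entries $1$ at positions $(i,i+1)$, $1\le i\le n-1$, and $0$ elsewhere. $\mathfrak{J}_{[n]}:=\{I_n+s_1\nu_n+\cdots+s_{n-1}\nu_n^{n-1}\mid s_1,\dots,s_{n-1}\in k[T],\ s_1\ne0\}$, and $\mathfrak{J}_{[n]}^E$ is the set of exponential matrices in $\mathfrak{J}_{[n]}$ (which is nonempty only if $n\le p$). For $y_1,\dots,y_\ell\in k$ let $J(y_1,\dots,y_\ell):=\sum_{i=0}^{\ell-1}y_{i+1}\nu_\ell^i\in\mathrm{Mat}(\ell,k)$ (with $\nu_\ell^0=I_\ell$). Given $y_1,\dots,y_{n-1}\in k$, define inductively $Q_1:=(y_1)$ and $Q_\ell:=\begin{pmatrix}1&\boldsymbol{0}\\ \boldsymbol{0}&Q_{\ell-1}\end{pmatrix}J(y_1,\dots,y_\ell)\in\mathrm{Mat}(\ell,k)$ for $2\le\ell\le n-1$. $\mathcal{Q}_{[n]}$ is the set of all regular matrices in $GL(n-1,k)$ of the form $Q_{n-1}$ for some $y_1,\dots,y_{n-1}\in k$ (regularity is equivalent to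 $y_1\ne0$). *)

theory Defs
  imports
    "Jordan_Normal_Form.Matrix"
    "HOL-Computational_Algebra.Polynomial"
begin

definition msum :: "nat \<Rightarrow> (nat \<Rightarrow> 'a::comm_ring_1 mat) \<Rightarrow> nat set \<Rightarrow> 'a mat" where
  "msum n F I = mat n n (\<lambda>(r, c). \<Sum>i\<in>I. F i $$ (r, c))"

abbreviation const_mat :: "'a::comm_ring_1 mat \<Rightarrow> 'a poly mat" where
  "const_mat \<equiv> map_mat (\<lambda>c. [:c:])"

text \<open>Polynomials in two variables over \<open>k\<close> are represented as \<open>k[T][T']\<close>, with type
  \<open>'a poly poly\<close>: the constant \<open>c\<close> is \<open>[:[:c:]:]\<close>, the inner variable is \<open>T\<close> and the
  outer variable is \<open>T'\<close>.\<close>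

definition var_T :: "'a::comm_ring_1 poly poly" where
  "var_T = [:[:0, 1:]:]"

definition var_T' :: "'a::comm_ring_1 poly poly" where
  "var_T' = [:0, 1:]"

definition eval2 :: "'a::comm_ring_1 poly poly \<Rightarrow> 'a poly \<Rightarrow> 'a poly poly" where
  "eval2 x q = poly (map_poly (\<lambda>c. [:[:c:]:]) q) x"

definition exponential_mat :: "nat \<Rightarrow> 'a::comm_ring_1 poly mat \<Rightarrow> bool" where
  "exponential_mat n A \<longleftrightarrow>
     A \<in> carrier_mat n n \<and>
     map_mat (\<lambda>q. poly q 0) A = 1\<^sub>m n \<and>
     map_mat (eval2 var_T) A * map_mat (eval2 var_T') A = map_mat (eval2 (var_T + var_T')) A"

definition p_polynomial :: "nat \<Rightarrow> 'a::comm_ring_1 poly \<Rightarrow> bool" where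
  "p_polynomial p f \<longleftrightarrow> (\<exists>(c :: nat \<Rightarrow> 'a) N. f = (\<Sum>i<N. monom (c i) (p ^ i)))"

text \<open>For \<open>i < p\<close> with \<open>p\<close> the characteristic, \<open>i!\<close> is invertible in the field \<open>k\<close>, so
  the division below is by a nonzero scalar.\<close>

definition trunc_Exp :: "nat \<Rightarrow> 'a::field poly mat \<Rightarrow> 'a poly mat" where
  "trunc_Exp p M = msum (dim_row M) (\<lambda>i. [:1 / of_nat (fact i):] \<cdot>\<^sub>m (M ^\<^sub>m i)) {0..<p}"

text \<open>The library indexes matrix entries from \<open>0\<close>.\<close>

definition nu :: "nat \<Rightarrow> 'a::comm_ring_1 mat" where
  "nu n = mat n n (\<lambda>(i, j). if j = i + 1 then 1 else 0)"

definition nu_comb :: "nat \<Rightarrow> (nat \<Rightarrow> 'a::comm_ring_1 poly) \<Rightarrow> 'a poly mat" where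
  "nu_comb n s = msum n (\<lambda>i. s i \<cdot>\<^sub>m (const_mat (nu n) ^\<^sub>m i)) {1..n-1}"

definition J_set :: "nat \<Rightarrow> 'a::comm_ring_1 poly mat set" where
  "J_set n = {1\<^sub>m n + nu_comb n s | s. s 1 \<noteq> 0}"

definition JE_set :: "nat \<Rightarrow> 'a::comm_ring_1 poly mat set" where
  "JE_set n = {A \<in> J_set n. exponential_mat n A}"

definition mat_equivalent :: "nat \<Rightarrow> 'a::field poly mat \<Rightarrow> 'a poly mat \<Rightarrow> bool" where
  "mat_equivalent n A B \<longleftrightarrow>
     (\<exists>P\<in>carrier_mat n n. \<exists>P'\<in>carrier_mat n n.
        inverts_mat P P' \<and> inverts_mat P' P \<and> const_mat P' * A * const_mat P = B)"

definition J_mat :: "(nat \<Rightarrow> 'a::comm_ring_1) \<Rightarrow> nat \<Rightarrow> 'a mat" where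
  "J_mat y l = msum l (\<lambda>i. y (i + 1) \<cdot>\<^sub>m (nu l ^\<^sub>m i)) {0..<l}"

text \<open>The value at size \<open>0\<close> is a dummy.\<close>

fun Q_mat :: "(nat \<Rightarrow> 'a::comm_ring_1) \<Rightarrow> nat \<Rightarrow> 'a mat" where
  "Q_mat y 0 = 1\<^sub>m 0"
| "Q_mat y (Suc 0) = mat 1 1 (\<lambda>_. y 1)"
| "Q_mat y (Suc (Suc l)) =
     four_block_mat (1\<^sub>m 1) (0\<^sub>m 1 (Suc l)) (0\<^sub>m (Suc l) 1) (Q_mat y (Suc l))
     * J_mat y (Suc (Suc l))"

definition Q_set :: "nat \<Rightarrow> 'a::field mat set" where
  "Q_set n = {Q_mat y (n - 1) | y. invertible_mat (Q_mat y (n - 1))}"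

definition row_of :: "nat \<Rightarrow> (nat \<Rightarrow> 'a poly) \<Rightarrow> 'a::comm_ring_1 poly mat" where
  "row_of n f = mat_of_row (vec (n - 1) (\<lambda>i. f (i + 1)))"

end

theory Submission
  imports Defs
    "Jordan_Normal_Form.Determinant"
    "HOL-Computational_Algebra.Formal_Power_Series"
    "HOL-Number_Theory.Cong"
begin

text \<open>A product of \<open>i\<close> many \<open>p\<close>-polynomials only has exponents congruent to \<open>i\<close> modulo \<open>p - 1\<close>, so the
  coefficients of \<open>\<Sum> f\<^sub>i \<nu>\<^sup>i\<close> can be read off from its truncated exponential, and a constant matrix
  \<open>P\<close> intertwines \<open>A\<close> with \<open>B\<close> iff it intertwines, for every exponent \<open>e\<close>, the
  upper triangular Toeplitz matrices given by the power series \<open>f\<^sub>e\<close>, \<open>g\<^sub>e\<close> of \<open>T\<^sup>e\<close>-coefficients.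
  If \<open>f\<^sub>e\<close> has a nonzero linear term, applying its compositional inverse shows that \<open>P\<close> intertwines
  \<open>\<nu>\<close> with \<open>\<Phi>(\<nu>)\<close> for some \<open>\<Phi> = y\<^sub>1 X + y\<^sub>2 X\<^sup>2 + \<dots>\<close>. Hence \<open>g\<^sub>e = f\<^sub>e \<circ> \<Phi>\<close> modulo \<open>X\<^sup>n\<close> for all \<open>e\<close>,
  and this substitution is right multiplication by \<open>Q\<close>. Conversely, the coefficients of
  \<open>1, \<Phi>, \<Phi>\<^sup>2, \<dots>\<close> are the rows of a suitable \<open>P\<close>.\<close>

section \<open>Upper triangular Toeplitz matrices as truncated power series\<close>

no_notation vec_index (infixl "$" 100)
unbundle fps_syntax

text \<open>This is \<open>u\<close> evaluated at \<open>nu n\<close>: the algebra generated by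
  \<open>nu n\<close> is the ring of power series modulo \<open>X ^ n\<close>, with
  \<open>nu n\<close> in the role of \<open>X\<close>.\<close>

definition Toep :: "nat \<Rightarrow> 'a::comm_ring_1 fps \<Rightarrow> 'a mat" where
  "Toep n u = mat n n (\<lambda>(i, j). if i \<le> j then u $ (j - i) else 0)"

lemma Toep_carrier [simp]: "Toep n u \<in> carrier_mat n n"
  and Toep_dim [simp]: "dim_row (Toep n u) = n" "dim_col (Toep n u) = n"
  by (simp_all add: Toep_def)

lemma Toep_index [simp]:
  "i < n \<Longrightarrow> j < n \<Longrightarrow> Toep n u $$ (i, j) = (if i \<le> j then u $ (j - i) else 0)"
  by (simp add: Toep_def)

lemma Toep_eq_iff: "Toep n u = Toep n v \<longleftrightarrow> (\<forall>i<n. u $ i = v $ i)"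
proof
  assume eq: "Toep n u = Toep n v"
  show "\<forall>i<n. u $ i = v $ i"
  proof (intro allI impI)
    fix i assume "i < n"
    then show "u $ i = v $ i"
      using arg_cong[OF eq, of "\<lambda>M. M $$ (0, i)"] by simp
  qed
qed (auto intro!: eq_matI)

lemma Toep_0: "Toep n 0 = 0\<^sub>m n n"
  and Toep_1: "Toep n 1 = 1\<^sub>m n"
  and Toep_const: "Toep n (fps_const c) = c \<cdot>\<^sub>m 1\<^sub>m n"
  and Toep_add: "Toep n (u + v) = Toep n u + Toep n v"
  by (auto intro!: eq_matI)

text \<open>Truncation at \<open>n\<close> does no harm: entry \<open>(i, j)\<close> only involves
  \<open>k\<close> between \<open>i\<close> and \<open>j\<close>, and these terms form the full
  Cauchy product in degree \<open>j - i\<close>.\<close>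

lemma Toep_mult: "Toep n (u * v) = Toep n u * Toep n v"
proof (rule eq_matI)
  fix i j assume "i < dim_row (Toep n u * Toep n v)" "j < dim_col (Toep n u * Toep n v)"
  then have ij: "i < n" "j < n" by auto
  have "(Toep n u * Toep n v) $$ (i, j) =
      (\<Sum>k\<in>{0..<n}. (if i \<le> k then u $ (k - i) else 0) * (if k \<le> j then v $ (j - k) else 0))"
    using ij by (simp add: scalar_prod_def)
  also have "\<dots> = (\<Sum>k\<in>{i..j}. u $ (k - i) * v $ (j - k))"
    using ij by (intro sum.mono_neutral_cong_right) auto
  also have "\<dots> = (if i \<le> j then (u * v) $ (j - i) else 0)"
  proof (cases "i \<le> j")
    case True
    have "(\<Sum>k\<in>{i..j}. u $ (k - i) * v $ (j - k)) =
        (\<Sum>k\<in>{0..j - i}. u $ k * v $ (j - i - k))"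
      by (rule sum.reindex_bij_witness[of _ "\<lambda>k. k + i" "\<lambda>k. k - i"])
        (use True in auto)
    with True show ?thesis by (simp add: fps_mult_nth)
  qed simp
  finally show "Toep n (u * v) $$ (i, j) = (Toep n u * Toep n v) $$ (i, j)"
    using ij by simp
qed auto

lemma Toep_power: "Toep n (u ^ k) = Toep n u ^\<^sub>m k"
  by (induction k) (simp_all add: Toep_1 Toep_mult mult.commute[of u])

section \<open>Toeplitz form of the matrices built from powers of \<open>nu\<close>\<close>

lemma nu_power: "nu n ^\<^sub>m k = Toep n (fps_X ^ k)"
proof -
  have "nu n = Toep n (fps_X :: 'a fps)"
    by (rule eq_matI) (auto simp: nu_def)
  then show ?thesis by (simp add: Toep_power)
qed

lemma const_mat_mult:
  assumes "M \<in> carrier_mat n n" "N \<in> carrier_mat n n"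
  shows "const_mat (M * N) = const_mat M * const_mat N"
proof -
  have sum: "[:\<Sum>x\<in>X. h x:] = (\<Sum>x\<in>X. [:h x:])" for h :: "nat \<Rightarrow> 'a" and X
    by (rule poly_eqI) (simp add: coeff_sum coeff_pCons split: nat.split)
  show ?thesis
    using assms by (intro eq_matI) (auto simp: scalar_prod_def sum mult.commute)
qed

lemma const_mat_one: "const_mat (1\<^sub>m n) = 1\<^sub>m n"
  by (rule eq_matI) (auto simp: one_pCons)

lemma nu_comb_eq_Toep: "nu_comb n s = Toep n (Abs_fps (\<lambda>i. if i = 0 then 0 else s i))"
proof (rule eq_matI)
  fix r c assume "r < dim_row (Toep n (Abs_fps (\<lambda>i. if i = 0 then 0 else s i)))"
    "c < dim_col (Toep n (Abs_fps (\<lambda>i. if i = 0 then 0 else s i)))"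
  then have rc: "r < n" "c < n" by auto
  have "const_mat (nu n) = Toep n (fps_X :: 'a poly fps)"
    by (rule eq_matI) (auto simp: nu_def)
  then have "nu_comb n s $$ (r, c) = (\<Sum>i\<in>{1..n-1}. if i = c - r \<and> r \<le> c then s i else 0)"
    using rc unfolding nu_comb_def msum_def
    by (auto simp flip: Toep_power intro!: sum.cong)
  also have "\<dots> = (if r < c then s (c - r) else 0)"
    using rc by (cases "r \<le> c") auto
  finally show "nu_comb n s $$ (r, c) =
      Toep n (Abs_fps (\<lambda>i. if i = 0 then 0 else s i)) $$ (r, c)"
    using rc by auto
qed (auto simp: nu_comb_def msum_def)

text \<open>The index shift makes this series \<open>\<Phi> / X\<close> for
  \<open>\<Phi> = y 1 * X + y 2 * X^2 + ...\<close>.\<close>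

lemma J_mat_eq_Toep: "J_mat y l = Toep l (Abs_fps (\<lambda>i. y (i + 1)))"
proof (rule eq_matI)
  fix r c assume "r < dim_row (Toep l (Abs_fps (\<lambda>i. y (i + 1))))"
    "c < dim_col (Toep l (Abs_fps (\<lambda>i. y (i + 1))))"
  then have rc: "r < l" "c < l" by auto
  have "J_mat y l $$ (r, c) = (\<Sum>i\<in>{0..<l}. if i = c - r \<and> r \<le> c then y (i + 1) else 0)"
    using rc by (auto simp: J_mat_def msum_def nu_power intro!: sum.cong)
  also have "\<dots> = (if r \<le> c then y (c - r + 1) else 0)"
    using rc by (cases "r \<le> c") auto
  finally show "J_mat y l $$ (r, c) = Toep l (Abs_fps (\<lambda>i. y (i + 1))) $$ (r, c)"
    using rc by simp
qed (auto simp: J_mat_def msum_def)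

section \<open>The matrices \<open>Q_mat\<close> as matrices of substitution\<close>

lemma Q_mat_carrier: "Q_mat y l \<in> carrier_mat l l"
  by (induction y l rule: Q_mat.induct) (auto simp: J_mat_def msum_def)

text \<open>Each step of the recursion multiplies by \<open>\<Phi>\<close>: the block matrix moves
  the smaller \<open>Q\<close> down and right, so that its row \<open>i\<close> lists the
  coefficients of \<open>\<Phi> ^ i\<close> from degree 0 on, and the factor \<open>J_mat\<close>
  then multiplies by \<open>\<Phi> / X\<close>. Thus right multiplication by \<open>Q_mat\<close>
  substitutes \<open>\<Phi>\<close> for \<open>X\<close> in series without constant term.\<close>

lemma Q_mat_index:
  assumes "i < l" "j < l"
  shows "Q_mat y l $$ (i, j) = (Abs_fps (\<lambda>i. if i = 0 then 0 else y i) ^ (i + 1)) $ (j + 1)"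
  using assms
proof (induction y l arbitrary: i j rule: Q_mat.induct)
  case (3 y l)
  let ?\<Phi> = "Abs_fps (\<lambda>i. if i = 0 then 0 else y i)"
  let ?m = "Suc (Suc l)"
  let ?D = "four_block_mat (1\<^sub>m 1) (0\<^sub>m 1 (Suc l)) (0\<^sub>m (Suc l) 1) (Q_mat y (Suc l))"
  have car: "Q_mat y (Suc l) \<in> carrier_mat (Suc l) (Suc l)" by (rule Q_mat_carrier)
  have D: "?D \<in> carrier_mat ?m ?m" using car by auto
  have "Q_mat y ?m $$ (i, j) =
      (\<Sum>k\<in>{0..<?m}. ?D $$ (i, k) * (if k \<le> j then y (j - k + 1) else 0))"
  proof -
    have "Q_mat y ?m $$ (i, j) =
        (\<Sum>k\<in>{0..<?m}. ?D $$ (i, k) * Toep ?m (Abs_fps (\<lambda>i. y (i + 1))) $$ (k, j))"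
      using 3(2,3) D by (simp add: J_mat_eq_Toep scalar_prod_def del: Toep_index index_mat_four_block)
    also have "\<dots> = (\<Sum>k\<in>{0..<?m}. ?D $$ (i, k) * (if k \<le> j then y (j - k + 1) else 0))"
      using 3(3) by (intro sum.cong) (simp_all del: index_mat_four_block)
    finally show ?thesis .
  qed
  also have "\<dots> = (?\<Phi> ^ (i + 1)) $ (j + 1)"
  proof (cases i)
    case 0
    have "(\<Sum>k\<in>{0..<?m}. ?D $$ (i, k) * (if k \<le> j then y (j - k + 1) else 0)) =
        (\<Sum>k\<in>{0..<?m}. if k = 0 then y (j + 1) else 0)"
      using 0 car by (intro sum.cong) auto
    then show ?thesis using 0 by simp
  next
    case (Suc i')
    have "(\<Sum>k\<in>{0..<?m}. ?D $$ (i, k) * (if k \<le> j then y (j - k + 1) else 0)) =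
        (\<Sum>k\<in>{0..<?m}. if k \<le> j then (?\<Phi> ^ i) $ k * ?\<Phi> $ (j + 1 - k) else 0)"
    proof (intro sum.cong refl)
      fix k assume k: "k \<in> {0..<?m}"
      show "?D $$ (i, k) * (if k \<le> j then y (j - k + 1) else 0) =
          (if k \<le> j then (?\<Phi> ^ i) $ k * ?\<Phi> $ (j + 1 - k) else 0)"
      proof (cases k)
        case 0
        then show ?thesis using Suc 3(2,3) car by simp
      next
        case (Suc k')
        moreover have "j - k' = Suc (j - Suc k')" if "Suc k' \<le> j" using that by simp
        ultimately show ?thesis
          using \<open>i = Suc i'\<close> 3(2,3) k car 3(1)[of i' k'] by auto
      qed
    qed
    \<comment> \<open>The Cauchy product has one more term, \<open>k = j + 1\<close>, which vanishes
      because \<open>\<Phi> $ 0 = 0\<close>.\<close>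
    also have "\<dots> = (\<Sum>k\<in>{0..j+1}. (?\<Phi> ^ i) $ k * ?\<Phi> $ (j + 1 - k))"
      using 3(2,3) by (intro sum.mono_neutral_cong) auto
    finally show ?thesis
      by (simp add: fps_mult_nth mult.commute[of ?\<Phi>])
  qed
  finally show ?case .
qed auto

section \<open>Invertible substitution matrices and transport of intertwining relations\<close>

lemma upper_triangular_invertible:
  fixes M :: "'a::field mat"
  assumes "M \<in> carrier_mat n n"
    and "\<And>i j. j < i \<Longrightarrow> i < n \<Longrightarrow> M $$ (i, j) = 0"
    and "\<And>i. i < n \<Longrightarrow> M $$ (i, i) \<noteq> 0"
  shows "\<exists>M'\<in>carrier_mat n n. inverts_mat M M' \<and> inverts_mat M' M"
proof -
  have "det M = prod_list (diag_mat M)"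
    using assms by (intro det_upper_triangular) auto
  also have "\<dots> \<noteq> 0"
    using assms by (auto simp: prod_list_zero_iff diag_mat_def)
  finally have "M \<in> Units (ring_mat TYPE('a) n ())"
    using assms(1) by (intro det_non_zero_imp_unit)
  then show ?thesis
    using assms(1) by (auto simp: Units_def ring_mat_def inverts_mat_def)
qed

lemma fps_power_nth_below:
  fixes u :: "'a::comm_ring_1 fps"
  assumes "u $ 0 = 0" "j < i"
  shows "(u ^ i) $ j = 0"
  using startsby_zero_power_prefix[OF assms(1), of i] assms(2) by simp

text \<open>The matrix is upper triangular with diagonal entries
  \<open>(\<Phi> $ 1) ^ (i + d)\<close>. The offset covers two uses: \<open>d = 1\<close> gives
  \<open>Q_mat\<close>, whose rows start with \<open>\<Phi>\<close>, and \<open>d = 0\<close> gives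
  an intertwining matrix whose rows start with \<open>\<Phi> ^ 0\<close>.\<close>

lemma substitution_mat_invertible:
  fixes \<Phi> :: "'a::field fps"
  assumes "\<Phi> $ 0 = 0" "\<Phi> $ 1 \<noteq> 0"
  shows "\<exists>M'\<in>carrier_mat n n. inverts_mat (mat n n (\<lambda>(i, j). (\<Phi> ^ (i + d)) $ (j + d))) M' \<and>
           inverts_mat M' (mat n n (\<lambda>(i, j). (\<Phi> ^ (i + d)) $ (j + d)))"
  using assms by (intro upper_triangular_invertible)
    (auto simp: fps_power_nth_below startsby_zero_power_nth_same)

text \<open>\<open>Toep n (u oo \<phi>)\<close> is \<open>u\<close> evaluated at
  \<open>Toep n \<phi>\<close>, and an intertwining relation between two matrices passes to every
  polynomial in them. Power series reduce to polynomials because only the coefficients of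
  \<open>u\<close> below \<open>n\<close> matter.\<close>

lemma Toep_intertwine_compose:
  fixes P :: "'a::field mat"
  assumes P: "P \<in> carrier_mat n n" and eq: "Toep n \<phi> * P = P * Toep n \<gamma>"
    and 0: "\<phi> $ 0 = 0" "\<gamma> $ 0 = 0"
  shows "Toep n (u oo \<phi>) * P = P * Toep n (u oo \<gamma>)"
proof -
  have fin: "Toep n (u oo \<phi>) * P = P * Toep n (u oo \<gamma>)" if "\<And>i. i \<ge> k \<Longrightarrow> u $ i = 0" for u k
    using that
  proof (induction k arbitrary: u)
    case 0
    then have "u = 0" by (intro fps_ext) auto
    then show ?case using P by (simp add: Toep_0)
  next
    case (Suc k)
    let ?v = "fps_shift 1 u"
    \<comment> \<open>Horner step: the shifted series satisfies the smaller degree bound, and one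
      factor \<open>X\<close> turns into \<open>\<phi>\<close> or \<open>\<gamma>\<close> after
      composition.\<close>
    have u: "u = fps_const (u $ 0) + fps_X * ?v"
      by (rule fps_ext) (auto simp: fps_X_mult_nth)
    have comp: "u oo w = fps_const (u $ 0) + w * (?v oo w)" if "w $ 0 = 0" for w
      using that by (subst u)
        (simp add: fps_compose_add_distrib fps_compose_mult_distrib)
    have IH: "Toep n (?v oo \<phi>) * P = P * Toep n (?v oo \<gamma>)"
      using Suc by simp
    have "Toep n (u oo \<phi>) * P = (u $ 0 \<cdot>\<^sub>m 1\<^sub>m n) * P + Toep n \<phi> * Toep n (?v oo \<phi>) * P"
      using P by (simp add: comp[OF 0(1)] Toep_add Toep_mult Toep_const
          add_mult_distrib_mat[of _ n n _ _ n] mult_carrier_mat[of _ n n _ n])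
    also have "Toep n \<phi> * Toep n (?v oo \<phi>) * P = Toep n \<phi> * (Toep n (?v oo \<phi>) * P)"
      using P by (intro assoc_mult_mat) auto
    also have "\<dots> = (Toep n \<phi> * P) * Toep n (?v oo \<gamma>)"
      unfolding IH using P by (intro assoc_mult_mat[symmetric]) auto
    also have "\<dots> = P * (Toep n \<gamma> * Toep n (?v oo \<gamma>))"
      unfolding eq using P by (intro assoc_mult_mat) auto
    also have "(u $ 0 \<cdot>\<^sub>m 1\<^sub>m n) * P = P * (u $ 0 \<cdot>\<^sub>m 1\<^sub>m n)"
      using P by (simp add: mult_smult_assoc_mat[of _ n n] mult_smult_distrib[of _ n n _ n])
    also have "P * (u $ 0 \<cdot>\<^sub>m 1\<^sub>m n) + P * (Toep n \<gamma> * Toep n (?v oo \<gamma>)) =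
        P * Toep n (u oo \<gamma>)"
      using P by (simp add: comp[OF 0(2)] Toep_add Toep_mult Toep_const
          mult_add_distrib_mat[of _ n n _ n] mult_carrier_mat[of _ n n _ n])
    finally show ?case .
  qed
  let ?c = "fps_cutoff n u"
  \<comment> \<open>Coefficient \<open>j\<close> of \<open>u oo w\<close> only uses the coefficients
    of \<open>u\<close> up to index \<open>j\<close>.\<close>
  have cut: "Toep n (u oo w) = Toep n (?c oo w)" for w
    by (auto simp: Toep_eq_iff fps_compose_nth intro!: sum.cong)
  show ?thesis
    unfolding cut by (rule fin[of n]) simp
qed

section \<open>Comparison of polynomial matrices exponent by exponent\<close>

abbreviation coeff_mat :: "nat \<Rightarrow> 'a::comm_ring_1 poly mat \<Rightarrow> 'a mat" where
  "coeff_mat e \<equiv> map_mat (\<lambda>q. coeff q e)"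

lemma coeff_mat_mult_const:
  assumes "M \<in> carrier_mat n n" "P \<in> carrier_mat n n"
  shows "coeff_mat e (M * const_mat P) = coeff_mat e M * P"
    and "coeff_mat e (const_mat P * M) = P * coeff_mat e M"
  using assms
  by (auto intro!: eq_matI sum.cong simp: scalar_prod_def coeff_sum mult.commute)

text \<open>As \<open>P\<close> is constant, multiplication by it does not mix different powers of
  T, so the identity splits into one identity over the field for each exponent.\<close>

lemma intertwine_iff_coeff_mat:
  assumes "M \<in> carrier_mat n n" "N \<in> carrier_mat n n" "P \<in> carrier_mat n n"
  shows "M * const_mat P = const_mat P * N \<longleftrightarrow>
    (\<forall>e. coeff_mat e M * P = P * coeff_mat e N)" (is "?L \<longleftrightarrow> ?R")
proof
  assume ?L
  then show ?R using coeff_mat_mult_const assms by metis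
next
  assume ?R
  then have eq: "coeff_mat e (M * const_mat P) = coeff_mat e (const_mat P * N)" for e
    using coeff_mat_mult_const assms by metis
  show ?L
  proof (intro eq_matI poly_eqI)
    fix i j e
    assume "i < dim_row (const_mat P * N)" "j < dim_col (const_mat P * N)"
    with assms show "coeff ((M * const_mat P) $$ (i, j)) e = coeff ((const_mat P * N) $$ (i, j)) e"
      using arg_cong[OF eq[of e], of "\<lambda>M. M $$ (i, j)"] by simp
  qed (use assms in auto)
qed

section \<open>Truncated exponentials of intertwined matrices\<close>

lemma msum_mult:
  assumes "\<And>i. i \<in> I \<Longrightarrow> F i \<in> carrier_mat n n" "C \<in> carrier_mat n n"
  shows "msum n F I * C = msum n (\<lambda>i. F i * C) I"
    and "C * msum n F I = msum n (\<lambda>i. C * F i) I"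
proof -
  show "msum n F I * C = msum n (\<lambda>i. F i * C) I"
  proof (rule eq_matI)
    fix r c assume "r < dim_row (msum n (\<lambda>i. F i * C) I)" "c < dim_col (msum n (\<lambda>i. F i * C) I)"
    then have rc: "r < n" "c < n" by (auto simp: msum_def)
    have d: "dim_row (F i) = n" "dim_col (F i) = n" if "i \<in> I" for i
      using assms(1)[OF that] by auto
    have "(msum n F I * C) $$ (r, c) = (\<Sum>k\<in>{0..<n}. \<Sum>i\<in>I. F i $$ (r, k) * C $$ (k, c))"
      using rc assms(2) by (simp add: msum_def scalar_prod_def sum_distrib_right)
    also have "\<dots> = (\<Sum>i\<in>I. \<Sum>k\<in>{0..<n}. F i $$ (r, k) * C $$ (k, c))"
      by (rule sum.swap)
    also have "\<dots> = (\<Sum>i\<in>I. (F i * C) $$ (r, c))"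
      using rc assms(2) d by (intro sum.cong) (auto simp: scalar_prod_def)
    finally show "(msum n F I * C) $$ (r, c) = msum n (\<lambda>i. F i * C) I $$ (r, c)"
      using rc by (simp add: msum_def)
  qed (use assms in \<open>auto simp: msum_def\<close>)
  show "C * msum n F I = msum n (\<lambda>i. C * F i) I"
  proof (rule eq_matI)
    fix r c assume "r < dim_row (msum n (\<lambda>i. C * F i) I)" "c < dim_col (msum n (\<lambda>i. C * F i) I)"
    then have rc: "r < n" "c < n" by (auto simp: msum_def)
    have d: "dim_row (F i) = n" "dim_col (F i) = n" if "i \<in> I" for i
      using assms(1)[OF that] by auto
    have "(C * msum n F I) $$ (r, c) = (\<Sum>k\<in>{0..<n}. \<Sum>i\<in>I. C $$ (r, k) * F i $$ (k, c))"
      using rc assms(2) by (simp add: msum_def scalar_prod_def sum_distrib_left)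
    also have "\<dots> = (\<Sum>i\<in>I. \<Sum>k\<in>{0..<n}. C $$ (r, k) * F i $$ (k, c))"
      by (rule sum.swap)
    also have "\<dots> = (\<Sum>i\<in>I. (C * F i) $$ (r, c))"
      using rc assms(2) d by (intro sum.cong) (auto simp: scalar_prod_def)
    finally show "(C * msum n F I) $$ (r, c) = msum n (\<lambda>i. C * F i) I $$ (r, c)"
      using rc by (simp add: msum_def)
  qed (use assms in \<open>auto simp: msum_def\<close>)
qed

lemma trunc_Exp_carrier: "M \<in> carrier_mat n n \<Longrightarrow> trunc_Exp p M \<in> carrier_mat n n"
  by (auto simp: trunc_Exp_def msum_def)

lemma trunc_Exp_intertwine:
  assumes M: "M \<in> carrier_mat n n" and N: "N \<in> carrier_mat n n" and C: "C \<in> carrier_mat n n"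
    and eq: "M * C = C * N"
  shows "trunc_Exp p M * C = C * trunc_Exp p N"
proof -
  have pow: "M ^\<^sub>m i * C = C * N ^\<^sub>m i" for i
  proof (induction i)
    case 0
    then show ?case using assms by simp
  next
    case (Suc i)
    have "M ^\<^sub>m Suc i * C = M ^\<^sub>m i * (C * N)"
      using M C by (simp add: assoc_mult_mat[of _ n n] flip: eq)
    also have "\<dots> = (C * N ^\<^sub>m i) * N"
      using M C N by (simp add: assoc_mult_mat[of _ n n, symmetric] flip: Suc)
    also have "\<dots> = C * N ^\<^sub>m Suc i"
      using C N by (simp add: assoc_mult_mat[of C n n _ n _ n])
    finally show ?case .
  qed
  have "dim_row M = n" "dim_row N = n" using M N by auto
  then show ?thesis
    using M N C pow
    by (simp add: trunc_Exp_def msum_mult mult_smult_assoc_mat[of _ n n]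
        mult_smult_distrib[of _ n n _ n])
qed

section \<open>Exponents modulo \<open>p - 1\<close> and recovery of a matrix from its truncated
  exponential\<close>

definition graded :: "nat \<Rightarrow> nat \<Rightarrow> 'a::comm_ring_1 poly \<Rightarrow> bool" where
  "graded d r q \<longleftrightarrow> (\<forall>e. coeff q e \<noteq> 0 \<longrightarrow> [e = r] (mod d))"

lemma graded_mult:
  assumes "graded d r q" "graded d s q'"
  shows "graded d (r + s) (q * q')"
  unfolding graded_def
proof (intro allI impI)
  fix e assume "coeff (q * q') e \<noteq> 0"
  then obtain i where "i \<le> e" "coeff q i * coeff q' (e - i) \<noteq> 0"
    unfolding coeff_mult by (metis (no_types, lifting) atMost_iff sum.neutral)
  then have "coeff q i \<noteq> 0" "coeff q' (e - i) \<noteq> 0" by auto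
  then have "[i + (e - i) = r + s] (mod d)"
    using assms unfolding graded_def by (intro cong_add) blast+
  then show "[e = r + s] (mod d)" using \<open>i \<le> e\<close> by simp
qed

lemma graded_sum: "(\<And>i. i \<in> I \<Longrightarrow> graded d r (q i)) \<Longrightarrow> graded d r (\<Sum>i\<in>I. q i)"
  unfolding graded_def coeff_sum by (meson sum.neutral)

lemma graded_mat_power:
  assumes M: "M \<in> carrier_mat n n" and gr: "\<And>i j. i < n \<Longrightarrow> j < n \<Longrightarrow> graded d 1 (M $$ (i, j))"
    and "i < n" "j < n"
  shows "graded d k ((M ^\<^sub>m k) $$ (i, j))"
  using assms(3,4)
proof (induction k arbitrary: i j)
  case 0
  then show ?case using M by (auto simp: graded_def)
next
  case (Suc k)
  have "(M ^\<^sub>m Suc k) $$ (i, j) = (\<Sum>l\<in>{0..<n}. (M ^\<^sub>m k) $$ (i, l) * M $$ (l, j))"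
    using M Suc.prems by (simp add: scalar_prod_def)
  moreover have "graded d (k + 1) ((M ^\<^sub>m k) $$ (i, l) * M $$ (l, j))" if "l < n" for l
    using Suc gr that by (intro graded_mult) auto
  ultimately show ?case by (auto intro!: graded_sum)
qed

text \<open>All exponents are powers of \<open>p\<close>, and \<open>p\<close> is congruent to 1
  modulo \<open>p - 1\<close>.\<close>

lemma p_polynomial_coeff:
  assumes "p_polynomial p q" "coeff q e \<noteq> 0" "p > 0"
  shows "e > 0" "[e = 1] (mod (p - 1))"
proof -
  obtain c N where q: "q = (\<Sum>i<N. monom (c i) (p ^ i))"
    using assms(1) unfolding p_polynomial_def by auto
  have "\<exists>i. e = p ^ i"
  proof (rule ccontr)
    assume "\<nexists>i. e = p ^ i"
    then have "coeff q e = 0" unfolding q coeff_sum by (intro sum.neutral) auto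
    with assms(2) show False by simp
  qed
  then obtain i where i: "e = p ^ i" by auto
  show "e > 0" using i assms(3) by simp
  have "[1 + (p - 1) = 1 + 0] (mod (p - 1))"
    by (intro cong_add) (auto simp: cong_def)
  then have "[p ^ i = 1 ^ i] (mod (p - 1))"
    using assms(3) by (intro cong_pow) simp
  then show "[e = 1] (mod (p - 1))" using i by simp
qed

text \<open>The entries of the \<open>i\<close>-th power of \<open>M\<close> only have exponents
  congruent to \<open>i\<close> modulo \<open>p - 1\<close>. For \<open>2 \<le> i < p\<close> this
  class differs from that of 1, since \<open>0 < i - 1 < p - 1\<close>. Only the linear term, whose
  factor is \<open>1 / 1! = 1\<close>, is left.\<close>

lemma coeff_mat_trunc_Exp:
  fixes M :: "'a::field poly mat"
  assumes M: "M \<in> carrier_mat n n"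
    and gr: "\<And>i j. i < n \<Longrightarrow> j < n \<Longrightarrow> graded (p - 1) 1 (M $$ (i, j))"
    and p: "p \<ge> 2" and e: "e > 0" "[e = 1] (mod (p - 1))"
  shows "coeff_mat e (trunc_Exp p M) = coeff_mat e M"
proof (rule eq_matI)
  fix r c assume "r < dim_row (coeff_mat e M)" "c < dim_col (coeff_mat e M)"
  then have rc: "r < n" "c < n" using M by auto
  have d: "dim_row M = n" "dim_col M = n" using M by auto
  have "coeff_mat e (trunc_Exp p M) $$ (r, c) =
      (\<Sum>i\<in>{0..<p}. coeff ([:1 / of_nat (fact i):] * (M ^\<^sub>m i) $$ (r, c)) e)"
    using rc d by (simp add: trunc_Exp_def msum_def coeff_sum)
  also have "\<dots> = (\<Sum>i\<in>{1}. coeff ([:1 / of_nat (fact i):] * (M ^\<^sub>m i) $$ (r, c)) e)"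
  proof (rule sum.mono_neutral_right)
    show "\<forall>i\<in>{0..<p} - {1}. coeff ([:1 / of_nat (fact i):] * (M ^\<^sub>m i) $$ (r, c)) e = 0"
    proof
      fix i assume i: "i \<in> {0..<p} - {1}"
      have "coeff ((M ^\<^sub>m i) $$ (r, c)) e = 0"
      proof (cases "i = 0")
        \<comment> \<open>For \<open>p = 2\<close> the congruence does not separate 0 from 1. The
          identity matrix is excluded by \<open>e > 0\<close> instead.\<close>
        case True
        then show ?thesis using rc d e by (auto simp: coeff_1)
      next
        case False
        show ?thesis
        proof (rule ccontr)
          assume "coeff ((M ^\<^sub>m i) $$ (r, c)) e \<noteq> 0"
          with graded_mat_power[OF M gr rc, where k = i] have "[e = i] (mod (p - 1))"
            unfolding graded_def by blast
          with e(2) have "[1 = i] (mod (p - 1))" by (metis cong_sym cong_trans)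
          then have "(p - 1) dvd (i - 1)"
            using i False by (auto simp: cong_altdef_nat cong_sym_eq)
          then show False using i False by (auto dest: dvd_imp_le)
        qed
      qed
      then show "coeff ([:1 / of_nat (fact i):] * (M ^\<^sub>m i) $$ (r, c)) e = 0" by simp
    qed
  qed (use p in auto)
  finally show "coeff_mat e (trunc_Exp p M) $$ (r, c) = coeff_mat e M $$ (r, c)"
    using rc d M by simp
qed (use M in \<open>auto simp: trunc_Exp_def msum_def\<close>)

section \<open>Equivalence in terms of the coefficient series\<close>

text \<open>The variable X of this series stands for \<open>nu\<close>, while T is frozen at
  exponent \<open>e\<close>. The constant term is set to 0, whatever \<open>s 0\<close> is, because
  \<open>nu_comb\<close> starts with the first power of \<open>nu\<close>; this also permits
  composition and compositional inverses.\<close>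

definition coeff_fps :: "nat \<Rightarrow> (nat \<Rightarrow> 'a::comm_ring_1 poly) \<Rightarrow> 'a fps" where
  "coeff_fps e s = Abs_fps (\<lambda>i. if i = 0 then 0 else coeff (s i) e)"

lemma nu_comb_carrier: "nu_comb n s \<in> carrier_mat n n"
  by (simp add: nu_comb_eq_Toep)

lemma coeff_mat_nu_comb: "coeff_mat e (nu_comb n s) = Toep n (coeff_fps e s)"
  by (rule eq_matI) (auto simp: nu_comb_eq_Toep coeff_fps_def)

text \<open>Clearing the inverse makes the condition linear in \<open>A\<close> and
  \<open>B\<close>, so that it can be tested on each coefficient of T.\<close>

lemma mat_equivalent_iff_intertwine:
  assumes "A \<in> carrier_mat n n" "B \<in> carrier_mat n n"
  shows "mat_equivalent n A B \<longleftrightarrow>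
    (\<exists>P\<in>carrier_mat n n. \<exists>P'\<in>carrier_mat n n. inverts_mat P P' \<and> inverts_mat P' P \<and>
       A * const_mat P = const_mat P * B)"
  unfolding mat_equivalent_def
proof (intro bex_cong refl conj_cong)
  fix P P' :: "'a mat"
  assume P: "P \<in> carrier_mat n n" "P' \<in> carrier_mat n n"
    and inv: "inverts_mat P P'" "inverts_mat P' P"
  let ?P = "const_mat P" and ?P' = "const_mat P'"
  have car: "?P \<in> carrier_mat n n" "?P' \<in> carrier_mat n n" using P by auto
  have one: "?P * ?P' = 1\<^sub>m n" "?P' * ?P = 1\<^sub>m n"
    using inv P by (auto simp: inverts_mat_def const_mat_one simp flip: const_mat_mult)
  show "?P' * A * ?P = B \<longleftrightarrow> A * ?P = ?P * B"
  proof
    assume "?P' * A * ?P = B"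
    then have "?P * B = ?P * (?P' * (A * ?P))"
      using car assms by (simp add: assoc_mult_mat[of _ n n])
    also have "\<dots> = ?P * ?P' * (A * ?P)"
      using car assms by (intro assoc_mult_mat[symmetric]) auto
    finally show "A * ?P = ?P * B" using one car assms by simp
  next
    assume eq: "A * ?P = ?P * B"
    have "?P' * A * ?P = ?P' * (?P * B)"
      unfolding eq[symmetric] using car assms by (intro assoc_mult_mat) auto
    also have "\<dots> = ?P' * ?P * B"
      using car assms by (intro assoc_mult_mat[symmetric]) auto
    finally show "?P' * A * ?P = B" using one assms by simp
  qed
qed

text \<open>From right to left, the coefficient identities assemble to an identity for
  \<open>nu_comb\<close>, which passes to the exponentials. From left to right, the exponentials
  determine the coefficients at exponents congruent to 1 modulo \<open>p - 1\<close>, and no others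
  occur in \<open>p\<close>-polynomials.\<close>

lemma trunc_Exp_intertwine_iff:
  fixes f g :: "nat \<Rightarrow> 'a::field poly"
  assumes p: "p \<ge> 2" and P: "P \<in> carrier_mat n n"
    and f: "\<forall>i\<in>{1..n-1}. p_polynomial p (f i)"
    and g: "\<forall>i\<in>{1..n-1}. p_polynomial p (g i)"
  shows "trunc_Exp p (nu_comb n f) * const_mat P = const_mat P * trunc_Exp p (nu_comb n g) \<longleftrightarrow>
    (\<forall>e. Toep n (coeff_fps e f) * P = P * Toep n (coeff_fps e g))" (is "?L \<longleftrightarrow> ?R")
proof
  assume ?R
  then have "nu_comb n f * const_mat P = const_mat P * nu_comb n g"
    using P by (subst intertwine_iff_coeff_mat[of _ n])
      (auto simp: coeff_mat_nu_comb nu_comb_carrier)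
  then show ?L
    using P by (intro trunc_Exp_intertwine[of _ n]) (auto simp: nu_comb_carrier)
next
  assume ?L
  then have L: "coeff_mat e (trunc_Exp p (nu_comb n f)) * P =
      P * coeff_mat e (trunc_Exp p (nu_comb n g))" for e
    using P by (subst (asm) intertwine_iff_coeff_mat[of _ n])
      (auto simp: trunc_Exp_carrier nu_comb_carrier)
  show ?R
  proof
    fix e
    show "Toep n (coeff_fps e f) * P = P * Toep n (coeff_fps e g)"
    proof (cases "e > 0 \<and> [e = 1] (mod (p - 1))")
      case True
      have "coeff_mat e (trunc_Exp p (nu_comb n s)) = Toep n (coeff_fps e s)"
        if s: "\<forall>i\<in>{1..n-1}. p_polynomial p (s i)" for s :: "nat \<Rightarrow> 'a poly"
        unfolding coeff_mat_nu_comb[symmetric]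
      proof (rule coeff_mat_trunc_Exp[OF nu_comb_carrier])
        fix i j assume "i < n" "j < n"
        moreover have "graded (p - 1) 1 (s (j - i))" if "i < j"
          unfolding graded_def
        proof (intro allI impI)
          fix e assume "coeff (s (j - i)) e \<noteq> 0"
          moreover have "p_polynomial p (s (j - i))"
            using that \<open>j < n\<close> by (intro s[rule_format]) auto
          ultimately show "[e = 1] (mod (p - 1))" using p
            by (intro p_polynomial_coeff(2)) auto
        qed
        ultimately show "graded (p - 1) 1 (nu_comb n s $$ (i, j))"
          by (auto simp: nu_comb_eq_Toep graded_def)
      qed (use True p in auto)
      then show ?thesis using L[of e] f g by simp
    next
      \<comment> \<open>No \<open>p\<close>-polynomial has a nonzero coefficient at such an
        \<open>e\<close>, so both sides are zero.\<close>
      case False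
      have "Toep n (coeff_fps e s) = 0\<^sub>m n n"
        if s: "\<forall>i\<in>{1..n-1}. p_polynomial p (s i)" for s :: "nat \<Rightarrow> 'a poly"
      proof -
        have "coeff (s i) e = 0" if "0 < i" "i < n" for i
          using False s that p p_polynomial_coeff[of p "s i" e] by fastforce
        then show ?thesis
          unfolding Toep_0[symmetric] Toep_eq_iff by (simp add: coeff_fps_def)
      qed
      then show ?thesis using f g P by simp
    qed
  qed
qed

section \<open>The row identity as a substitution in all coefficient series\<close>

lemma row_of_Q_mat_iff:
  fixes f g :: "nat \<Rightarrow> 'a::field poly"
  assumes "n \<ge> 1"
  defines "\<Phi> y \<equiv> Abs_fps (\<lambda>i. if i = 0 then 0 else y i)"
  shows "row_of n g = row_of n f * const_mat (Q_mat y (n - 1)) \<longleftrightarrow>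
    (\<forall>e. Toep n (coeff_fps e g) = Toep n (coeff_fps e f oo \<Phi> y))" (is "?L \<longleftrightarrow> ?R")
proof -
  have Q: "dim_row (Q_mat y (n - 1)) = n - 1" "dim_col (Q_mat y (n - 1)) = n - 1"
    using Q_mat_carrier[of y "n - 1"] by auto
  have entry: "coeff ((row_of n f * const_mat (Q_mat y (n - 1))) $$ (0, j)) e =
      (coeff_fps e f oo \<Phi> y) $ (Suc j)" if j: "j < n - 1" for j e
  proof -
    have "coeff ((row_of n f * const_mat (Q_mat y (n - 1))) $$ (0, j)) e =
        (\<Sum>i\<in>{0..<n-1}. coeff (f (Suc i)) e * (\<Phi> y ^ Suc i) $ Suc j)"
      using j Q by (simp add: row_of_def mat_of_row_def scalar_prod_def coeff_sum
          Q_mat_index \<Phi>_def mult.commute)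
    \<comment> \<open>\<open>\<Phi> y ^ Suc i\<close> has no terms below degree
      \<open>Suc i\<close>, so the terms with \<open>i > j\<close> drop out and the sum becomes the
      one that defines composition.\<close>
    also have "\<dots> = (\<Sum>i\<in>{0..j}. coeff (f (Suc i)) e * (\<Phi> y ^ Suc i) $ Suc j)"
      using j by (intro sum.mono_neutral_right)
        (auto simp: fps_power_nth_below \<Phi>_def simp del: power_Suc)
    also have "\<dots> = (\<Sum>i\<in>{Suc 0..Suc j}. coeff_fps e f $ i * (\<Phi> y ^ i) $ Suc j)"
      by (subst sum.shift_bounds_cl_Suc_ivl) (simp add: coeff_fps_def)
    also have "\<dots> = (coeff_fps e f oo \<Phi> y) $ (Suc j)"
      unfolding fps_compose_nth
      by (rule sum.mono_neutral_left) (auto simp: coeff_fps_def not_less_eq_eq)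
    finally show ?thesis .
  qed
  have "?L \<longleftrightarrow> (\<forall>j<n-1. g (Suc j) = (row_of n f * const_mat (Q_mat y (n - 1))) $$ (0, j))"
    (is "_ \<longleftrightarrow> ?M")
  proof
    assume eq: ?L
    show ?M unfolding eq[symmetric] by (simp add: row_of_def mat_of_row_def)
  next
    assume ?M
    then show ?L
      using Q by (intro eq_matI) (auto simp: row_of_def mat_of_row_def)
  qed
  also have "\<dots> \<longleftrightarrow> (\<forall>e. \<forall>j<n-1. coeff_fps e g $ Suc j = (coeff_fps e f oo \<Phi> y) $ Suc j)"
  proof -
    have "coeff_fps e g $ Suc j = coeff (g (Suc j)) e" for e j by (simp add: coeff_fps_def)
    then show ?thesis by (auto simp: poly_eq_iff entry simp del: One_nat_def)
  qed
  also have "\<dots> \<longleftrightarrow> ?R"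
  proof -
    \<comment> \<open>The extra index 0 imposes nothing: both series have constant term 0.\<close>
    have "(\<forall>j<n-1. coeff_fps e g $ Suc j = (coeff_fps e f oo \<Phi> y) $ Suc j) \<longleftrightarrow>
        (\<forall>j<n. coeff_fps e g $ j = (coeff_fps e f oo \<Phi> y) $ j)" for e
    proof -
      obtain m where "n = Suc m" using assms(1) by (cases n) auto
      then show ?thesis by (simp add: All_less_Suc2 coeff_fps_def)
    qed
    then show ?thesis by (simp add: Toep_eq_iff)
  qed
  finally show ?thesis .
qed

section \<open>Passage from intertwining matrices to substitutions and back\<close>

lemma mat_left_cancel:
  fixes M N :: "'a::comm_ring_1 mat"
  assumes "P \<in> carrier_mat n n" "P' \<in> carrier_mat n n" "inverts_mat P' P"
    and "M \<in> carrier_mat n n" "N \<in> carrier_mat n n" and eq: "P * M = P * N"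
  shows "M = N"
proof -
  have one: "P' * P = 1\<^sub>m n" using assms by (auto simp: inverts_mat_def)
  have "M = P' * P * M" using one assms by simp
  also have "\<dots> = P' * (P * M)" using assms by (intro assoc_mult_mat) auto
  also have "\<dots> = P' * P * N" unfolding eq using assms by (intro assoc_mult_mat[symmetric]) auto
  finally show ?thesis using one assms by simp
qed

theorem corollary1p38:
  fixes A B :: "'a::field poly mat" and f g :: "nat \<Rightarrow> 'a poly" and n p :: nat
  assumes char: "CHAR('a) = p" "p > 0"
    and n: "n \<ge> 2"
    and A_mem: "A \<in> JE_set n" and B_mem: "B \<in> JE_set n"
    and A_form: "A = trunc_Exp p (nu_comb n f)"
    and B_form: "B = trunc_Exp p (nu_comb n g)"
    and f: "\<forall>i\<in>{1..n-1}. p_polynomial p (f i)" "f 1 \<noteq> 0"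
    and g: "\<forall>i\<in>{1..n-1}. p_polynomial p (g i)" "g 1 \<noteq> 0"
  shows "mat_equivalent n A B \<longleftrightarrow>
         (\<exists>Q\<in>Q_set n. row_of n g = row_of n f * const_mat Q)"
proof -
  define \<Phi> :: "(nat \<Rightarrow> 'a) \<Rightarrow> 'a fps" where "\<Phi> y = Abs_fps (\<lambda>i. if i = 0 then 0 else y i)" for y
  have \<Phi>: "\<Phi> y $ 0 = 0" "\<Phi> y $ 1 = y 1" for y by (simp_all add: \<Phi>_def)
  have "p \<noteq> 1" using char(1) CHAR_not_1[where 'a = 'a] by simp
  then have p: "p \<ge> 2" using char(2) by simp
  have equiv: "mat_equivalent n A B \<longleftrightarrow>
      (\<exists>P\<in>carrier_mat n n. \<exists>P'\<in>carrier_mat n n. inverts_mat P P' \<and> inverts_mat P' P \<and>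
        (\<forall>e. Toep n (coeff_fps e f) * P = P * Toep n (coeff_fps e g)))"
    unfolding A_form B_form using trunc_Exp_intertwine_iff[OF p _ f(1) g(1)]
    by (subst mat_equivalent_iff_intertwine)
      (auto intro: trunc_Exp_carrier nu_comb_carrier)
  have row: "row_of n g = row_of n f * const_mat (Q_mat y (n - 1)) \<longleftrightarrow>
      (\<forall>e. Toep n (coeff_fps e g) = Toep n (coeff_fps e f oo \<Phi> y))" for y
    using row_of_Q_mat_iff[of n g f y] n by (simp add: \<Phi>_def)
  \<comment> \<open>The linear coefficient of \<open>coeff_fps e f oo \<Phi> y\<close> is a multiple
    of \<open>y 1\<close>. If \<open>y 1\<close> were 0, every coefficient of \<open>g 1\<close>
    would vanish.\<close>
  have y1: "y 1 \<noteq> 0" if eq: "\<And>e. Toep n (coeff_fps e g) = Toep n (coeff_fps e f oo \<Phi> y)" for y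
  proof
    assume "y 1 = 0"
    then have "(coeff_fps e f oo \<Phi> y) $ 1 = 0" for e
      using \<Phi>[of y] by (simp add: fps_compose_nth)
    then have "coeff_fps e g $ 1 = 0" for e
      using eq[of e] n by (simp add: Toep_eq_iff)
    then have "g 1 = 0" by (simp add: poly_eq_iff coeff_fps_def)
    with g(2) show False by simp
  qed
  show ?thesis
  proof
    assume "mat_equivalent n A B"
    then obtain P P' where P: "P \<in> carrier_mat n n" "P' \<in> carrier_mat n n" "inverts_mat P' P"
      and eq: "\<And>e. Toep n (coeff_fps e f) * P = P * Toep n (coeff_fps e g)"
      unfolding equiv by blast
    \<comment> \<open>Any exponent occurring in \<open>f 1\<close> will do: its coefficient series
      has a nonzero linear term and hence a compositional inverse.\<close>
    obtain e where e: "coeff (f 1) e \<noteq> 0" using f(2) by (auto simp: poly_eq_iff)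
    let ?\<phi> = "coeff_fps e f"
    have zero: "coeff_fps e s $ 0 = 0" for e and s :: "nat \<Rightarrow> 'a poly"
      by (simp add: coeff_fps_def)
    have one: "?\<phi> $ 1 \<noteq> 0" using e by (simp add: coeff_fps_def)
    \<comment> \<open>The substitution must satisfy
      \<open>coeff_fps e g = coeff_fps e f oo \<Psi>\<close>; solving this at the chosen
      \<open>e\<close> gives the formula.\<close>
    define \<Psi> where "\<Psi> = fps_inv ?\<phi> oo coeff_fps e g"
    have \<Psi>0: "\<Psi> $ 0 = 0" by (simp add: \<Psi>_def fps_inv_def)
    have y: "\<Phi> (fps_nth \<Psi>) = \<Psi>" by (rule fps_ext) (simp add: \<Phi>_def \<Psi>0)
    have X: "Toep n fps_X * P = P * Toep n \<Psi>"
      using Toep_intertwine_compose[OF P(1) eq[of e] zero zero, of "fps_inv ?\<phi>"]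
        fps_inv[OF zero one] by (simp add: \<Psi>_def)
    \<comment> \<open>Here \<open>e\<close> is arbitrary again. Since \<open>P\<close> intertwines
      \<open>X\<close> with \<open>\<Psi>\<close>, it intertwines each \<open>coeff_fps e f\<close>
      with its composite with \<open>\<Psi>\<close> as well as with \<open>coeff_fps e g\<close>;
      cancelling \<open>P\<close> identifies the two modulo \<open>X ^ n\<close>.\<close>
    have sub: "Toep n (coeff_fps e g) = Toep n (coeff_fps e f oo \<Phi> (fps_nth \<Psi>))" for e
    proof (rule mat_left_cancel[OF P])
      show "P * Toep n (coeff_fps e g) = P * Toep n (coeff_fps e f oo \<Phi> (fps_nth \<Psi>))"
        using Toep_intertwine_compose[OF P(1) X, of "coeff_fps e f"] \<Psi>0 eq[of e] y by simp
    qed auto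
    let ?Q = "Q_mat (fps_nth \<Psi>) (n - 1)"
    have "?Q = mat (n - 1) (n - 1) (\<lambda>(i, j). (\<Phi> (fps_nth \<Psi>) ^ (i + 1)) $ (j + 1))"
      using Q_mat_carrier[of "fps_nth \<Psi>" "n - 1"]
      by (intro eq_matI) (auto simp: Q_mat_index \<Phi>_def)
    then have "invertible_mat ?Q"
      using substitution_mat_invertible[of "\<Phi> (fps_nth \<Psi>)" "n - 1" 1] y1[OF sub] \<Phi>
      by (auto simp: invertible_mat_def square_mat.simps)
    then have "?Q \<in> Q_set n" by (auto simp: Q_set_def)
    then show "\<exists>Q\<in>Q_set n. row_of n g = row_of n f * const_mat Q"
      using row sub by blast
  next
    assume "\<exists>Q\<in>Q_set n. row_of n g = row_of n f * const_mat Q"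
    then obtain y where "row_of n g = row_of n f * const_mat (Q_mat y (n - 1))"
      by (auto simp: Q_set_def)
    then have sub: "Toep n (coeff_fps e g) = Toep n (coeff_fps e f oo \<Phi> y)" for e
      using row by blast
    \<comment> \<open>Row \<open>i\<close> lists the coefficients of \<open>\<Phi> y ^ i\<close>.
      Left multiplication by \<open>nu\<close> moves row \<open>i + 1\<close> into row
      \<open>i\<close>, and right multiplication by \<open>Toep n (\<Phi> y)\<close> multiplies each
      row by \<open>\<Phi> y\<close>; the two effects agree.\<close>
    define P where "P = mat n n (\<lambda>(i, j). (\<Phi> y ^ i) $ j)"
    have P: "P \<in> carrier_mat n n" by (simp add: P_def)
    obtain P' where P': "P' \<in> carrier_mat n n" "inverts_mat P P'" "inverts_mat P' P"
      using substitution_mat_invertible[of "\<Phi> y" n 0] y1[OF sub] \<Phi>[of y]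
      by (auto simp: P_def)
    have X: "Toep n fps_X * P = P * Toep n (\<Phi> y)"
    proof (rule eq_matI)
      fix i j assume "i < dim_row (P * Toep n (\<Phi> y))" "j < dim_col (P * Toep n (\<Phi> y))"
      then have ij: "i < n" "j < n" using P by auto
      have "(Toep n fps_X * P) $$ (i, j) =
          (\<Sum>k\<in>{0..<n}. (if i \<le> k then fps_X $ (k - i) else 0) * (\<Phi> y ^ k) $ j)"
        using ij by (simp add: P_def scalar_prod_def)
      also have "\<dots> = (\<Sum>k\<in>{0..<n}. if k = Suc i then (\<Phi> y ^ k) $ j else 0)"
        by (intro sum.cong refl) auto
      \<comment> \<open>In the last row, \<open>Suc i = n\<close> is outside the range and the sum
        is 0; the right side is 0 too, since \<open>\<Phi> y ^ n\<close> has no terms below degree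
        \<open>n\<close>.\<close>
      also have "\<dots> = (\<Phi> y ^ Suc i) $ j"
        using ij \<Phi>[of y] by (auto simp: fps_power_nth_below simp del: power_Suc)
      also have "\<dots> = (\<Sum>k\<in>{0..j}. (\<Phi> y ^ i) $ k * \<Phi> y $ (j - k))"
        by (simp add: fps_mult_nth mult.commute[of "\<Phi> y"])
      also have "\<dots> = (\<Sum>k\<in>{0..<n}. (\<Phi> y ^ i) $ k * (if k \<le> j then \<Phi> y $ (j - k) else 0))"
        using ij by (intro sum.mono_neutral_cong_left) auto
      also have "\<dots> = (P * Toep n (\<Phi> y)) $$ (i, j)"
        using ij by (simp add: P_def scalar_prod_def)
      finally show "(Toep n fps_X * P) $$ (i, j) = (P * Toep n (\<Phi> y)) $$ (i, j)" .
    qed (use P in auto)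
    have "Toep n (coeff_fps e f) * P = P * Toep n (coeff_fps e g)" for e
      using Toep_intertwine_compose[OF P X, of "coeff_fps e f"] \<Phi>[of y] sub[of e] by simp
    then show "mat_equivalent n A B" unfolding equiv using P P' by blast
  qed
qed

end
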